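(* Let $(\tau,\cdot[\cdot])$ be a system of ordinal notations with fundamental sequences and master sequence $(\tau_n)_{n<\omega}$ satisfying assumptions (1)–(5) of the context, and let $k\ge 2$. Then the restriction $G_k^*$ of $G_k$ to the maximality quotient $\tau/G_k$, $$G_k^*:\ \tau/G_k\to\mathbb{N},$$ is an order isomorphism (with respect to the usual orders on ordinals and natural numbers), and the restriction of $P_k$ to $\tau/G_k$ is the true predecessor function on $\tau/G_k$, i.e. $P_k(0)=0$ and for each nonzero $\alpha\in\tau/G_k$ the ordinal $P_k(\alpha)$ is the largest element of $\tau/G_k$ that is smaller than $\alpha$.
   Context: Setting: $\tau$ is a countable limit ordinal, and to every $\alpha<\tau$ and $n<\omega$ an ordinal $\alpha[n]<\tau$ is assigned such that: (1) $0[n]=1[n]=0$ for all $n<\omega$; (2) $(\xi+\eta)[n]=\xi+\eta[n]$ for all $n<\omega$ and all $\xi,\eta$ with $\eta>0$, $\xi+\eta<\tau$ and $\xi+\eta$ in normal form, meaning that $\xi=0$ or the last (smallest) exponent in the Cantor normal form of $\xi$ is $\ge$ the first (largest) exponent in the Cantor normal form of $\eta$; (3) for every limit ordinal $\lambda<\tau$ the sequence $(\lambda[n])_{n<\omega}$ is strictly increasing with supremum $\lambda$, and $\lambda[0]>0$; (4) (Bachmann property) for all $\alpha,\beta<\tau$ and $n<\omega$: if $\alpha[n]<\beta<\alpha$, then $\alpha[n]\le\beta[0]$; (5) there is given a strictly increasing sequence $(\tau_n)_{n<\omega}$ of ordinals below $\tau$ (the master sequence) with $\sup\{\tau_n\mid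 n<\omega\}=\tau$ and $\tau_{n+1}[0]=\tau_n$ for all $n<\omega$. For $k>0$, the function $G_k:\tau\to\omega$ is defined by $G_k(0)=0$, $G_k(\alpha+1)=G_k(\alpha)+1$, $G_k(\lambda)=G_k(\lambda[k-1])$ for limits $\lambda$; the function $P_k:\tau\to\tau$ is defined by $P_k(0)=0$, $P_k(\alpha+1)=\alpha$, $P_k(\lambda)=P_k(\lambda[k-1])$ for limits $\lambda$. For $k\ge 2$ and every $m<\omega$ the set $\{\alpha<\tau\mid G_k(\alpha)=m\}$ has a maximum, and the maximality quotient is $\tau/G_k:=\{\max\{\alpha<\tau\mid G_k(\alpha)=m\}\mid m<\omega\}$. *)

theory Defs
  imports Complex_Main "HOL-Library.Countable_Set"
begin

section \<open>The countable ordinals\<close>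

text \<open>The countable ordinals are the elements of the initial ordinal of the successor cardinal of
  \<open>\<aleph>\<^sub>0\<close>. The supremum of a countable set of countable ordinals therefore always exists
  (lemma \<open>countable_imp_bdd_above\<close> below).\<close>

typedef countable_ordinal = "Field (cardSuc natLeq)"
proof -
  have "infinite (Field (cardSuc natLeq))"
    using cardSuc_finite[OF natLeq_Card_order] by (simp add: Field_natLeq)
  then show ?thesis
    by (metis ex_in_conv finite.emptyI)
qed

lemma wo_omega1: "Well_order (cardSuc natLeq)"
  using cardSuc_Card_order[OF natLeq_Card_order] unfolding card_order_on_def by blast

instantiation countable_ordinal :: wellorder
begin

definition "\<alpha> \<le> \<beta> \<longleftrightarrow> (Rep_countable_ordinal \<alpha>, Rep_countable_ordinal \<beta>) \<in> cardSuc natLeq"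

definition "\<alpha> < \<beta> \<longleftrightarrow> \<alpha> \<le> \<beta> \<and> \<alpha> \<noteq> (\<beta> :: countable_ordinal)"

instance
proof
  note wo = wo_omega1[unfolded well_order_on_def linear_order_on_def partial_order_on_def
      preorder_on_def]
  fix \<alpha> \<beta> \<gamma> :: countable_ordinal
  show refl: "\<alpha> \<le> \<alpha>" for \<alpha> :: countable_ordinal
    unfolding less_eq_countable_ordinal_def
    using wo Rep_countable_ordinal[of \<alpha>] by (auto simp: refl_on_def)
  show antisym: "\<alpha> \<le> \<beta> \<Longrightarrow> \<beta> \<le> \<alpha> \<Longrightarrow> \<alpha> = \<beta>" for \<alpha> \<beta> :: countable_ordinal
    unfolding less_eq_countable_ordinal_def
    using wo by (meson antisymD Rep_countable_ordinal_inject)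
  show "\<alpha> \<le> \<beta> \<Longrightarrow> \<beta> \<le> \<gamma> \<Longrightarrow> \<alpha> \<le> \<gamma>"
    unfolding less_eq_countable_ordinal_def using wo by (meson transD)
  show "(\<alpha> < \<beta>) = (\<alpha> \<le> \<beta> \<and> \<not> \<beta> \<le> \<alpha>)"
    unfolding less_countable_ordinal_def using refl antisym by blast
  show "\<alpha> \<le> \<beta> \<or> \<beta> \<le> \<alpha>"
  proof (cases "\<alpha> = \<beta>")
    case False
    then have "Rep_countable_ordinal \<alpha> \<noteq> Rep_countable_ordinal \<beta>"
      by (simp add: Rep_countable_ordinal_inject)
    then show ?thesis
      unfolding less_eq_countable_ordinal_def
      using wo Rep_countable_ordinal[of \<alpha>] Rep_countable_ordinal[of \<beta>]
      by (auto simp: total_on_def)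
  qed (simp add: refl)
next
  fix P :: "countable_ordinal \<Rightarrow> bool" and \<alpha>
  assume step: "\<And>\<alpha>. (\<And>\<beta>. \<beta> < \<alpha> \<Longrightarrow> P \<beta>) \<Longrightarrow> P \<alpha>"
  have "wf (inv_image (cardSuc natLeq - Id) Rep_countable_ordinal)"
    using wo_omega1 unfolding well_order_on_def by (intro wf_inv_image) blast
  then show "P \<alpha>"
  proof (induction \<alpha> rule: wf_induct_rule)
    case (less \<alpha>)
    show ?case
      by (rule step, rule less)
        (auto simp: less_countable_ordinal_def less_eq_countable_ordinal_def inv_image_def
          Rep_countable_ordinal_inject)
  qed
qed

end

instantiation countable_ordinal :: conditionally_complete_linorder
begin

definition "inf \<alpha> \<beta> = min \<alpha> (\<beta> :: countable_ordinal)"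

definition "sup \<alpha> \<beta> = max \<alpha> (\<beta> :: countable_ordinal)"

definition "Inf X = (LEAST \<alpha> :: countable_ordinal. \<alpha> \<in> X)"

definition "Sup X = (LEAST \<alpha> :: countable_ordinal. \<forall>\<beta>\<in>X. \<beta> \<le> \<alpha>)"

instance
proof
  fix \<alpha> \<beta> :: countable_ordinal and X :: "countable_ordinal set"
  show "\<alpha> \<in> X \<Longrightarrow> Inf X \<le> \<alpha>"
    unfolding Inf_countable_ordinal_def by (rule Least_le)
  show "X \<noteq> {} \<Longrightarrow> (\<And>\<beta>. \<beta> \<in> X \<Longrightarrow> \<alpha> \<le> \<beta>) \<Longrightarrow> \<alpha> \<le> Inf X"
    unfolding Inf_countable_ordinal_def by (metis LeastI_ex ex_in_conv)
  show "\<alpha> \<in> X \<Longrightarrow> bdd_above X \<Longrightarrow> \<alpha> \<le> Sup X"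
    unfolding Sup_countable_ordinal_def bdd_above_def
    using LeastI_ex[of "\<lambda>\<alpha>. \<forall>\<beta>\<in>X. \<beta> \<le> \<alpha>"] by blast
  show "X \<noteq> {} \<Longrightarrow> (\<And>\<beta>. \<beta> \<in> X \<Longrightarrow> \<beta> \<le> \<alpha>) \<Longrightarrow> Sup X \<le> \<alpha>"
    unfolding Sup_countable_ordinal_def by (rule Least_le) blast
qed (auto simp: inf_countable_ordinal_def sup_countable_ordinal_def)

end

lemma countable_atMost_ordinal:
  includes cardinal_syntax
  shows "countable {..\<alpha> :: countable_ordinal}"
proof -
  let ?a = "Rep_countable_ordinal \<alpha>"
  have "|underS (cardSuc natLeq) ?a| <o cardSuc natLeq"
    by (rule card_of_underS[OF cardSuc_Card_order[OF natLeq_Card_order] Rep_countable_ordinal])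
  then have "|underS (cardSuc natLeq) ?a| \<le>o natLeq"
    using cardSuc_ordLeq_ordLess[OF natLeq_Card_order card_of_Card_order] by blast
  then have "|underS (cardSuc natLeq) ?a| \<le>o |UNIV :: nat set|"
    using card_of_nat ordIso_symmetric ordLeq_ordIso_trans by blast
  then have "countable (underS (cardSuc natLeq) ?a)"
    unfolding card_of_ordLeq[symmetric] countable_def by blast
  moreover have "Rep_countable_ordinal ` {..<\<alpha>} \<subseteq> underS (cardSuc natLeq) ?a"
    by (auto simp: underS_def less_countable_ordinal_def less_eq_countable_ordinal_def
        Rep_countable_ordinal_inject)
  ultimately have "countable (Rep_countable_ordinal ` {..<\<alpha>})"
    using countable_subset by blast
  then have "countable {..<\<alpha>}"
    by (rule countable_image_inj_on) (simp add: inj_on_def Rep_countable_ordinal_inject)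
  moreover have "{..\<alpha>} = insert \<alpha> {..<\<alpha>}"
    by auto
  ultimately show ?thesis
    by simp
qed

lemma countable_lessThan_ordinal: "countable {..<\<alpha> :: countable_ordinal}"
  by (rule countable_subset[OF _ countable_atMost_ordinal[of \<alpha>]]) auto

lemma uncountable_UNIV_ordinal:
  includes cardinal_syntax
  shows "\<not> countable (UNIV :: countable_ordinal set)"
proof
  assume "countable (UNIV :: countable_ordinal set)"
  then have "countable (Field (cardSuc natLeq))"
    by (metis countable_image type_definition.Rep_range type_definition_countable_ordinal)
  then have "|Field (cardSuc natLeq)| \<le>o |UNIV :: nat set|"
    unfolding card_of_ordLeq[symmetric] countable_def by blast
  then have "cardSuc natLeq \<le>o natLeq"
    using card_of_Field_ordIso[OF cardSuc_Card_order[OF natLeq_Card_order]] card_of_nat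
    by (meson ordIso_ordLeq_trans ordIso_symmetric ordLeq_ordIso_trans)
  then show False
    using cardSuc_greater[OF natLeq_Card_order] not_ordLess_ordLeq by blast
qed

lemma countable_imp_bdd_above:
  fixes X :: "countable_ordinal set"
  assumes "countable X"
  shows "bdd_above X"
proof (rule ccontr)
  assume *: "\<not> bdd_above X"
  have "(\<Union>x\<in>X. {..x}) = UNIV"
  proof (rule ccontr)
    assume "(\<Union>x\<in>X. {..x}) \<noteq> UNIV"
    then obtain z where "\<forall>x\<in>X. \<not> z \<le> x"
      by auto
    then have "bdd_above X"
      by (intro bdd_aboveI[of _ z]) auto
    with * show False ..
  qed
  then show False
    using assms countable_UN[of X atMost] countable_atMost_ordinal uncountable_UNIV_ordinal by simp
qed


section \<open>Ordinal arithmetic\<close>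

lemma wf_ordinal: "wf {(\<alpha>, \<beta> :: countable_ordinal). \<alpha> < \<beta>}"
  by (rule wf)

definition osuc :: "countable_ordinal \<Rightarrow> countable_ordinal" where
  "osuc \<alpha> = (LEAST \<beta>. \<alpha> < \<beta>)"

instantiation countable_ordinal :: "{zero, one, plus, times}"
begin

definition "0 = (LEAST \<alpha> :: countable_ordinal. True)"

definition "1 = osuc 0"

function plus_countable_ordinal :: "countable_ordinal \<Rightarrow> countable_ordinal \<Rightarrow> countable_ordinal"
  where "plus_countable_ordinal \<alpha> \<beta> =
    (if \<beta> = 0 then \<alpha> else SUP \<gamma>\<in>{..<\<beta>}. osuc (plus_countable_ordinal \<alpha> \<gamma>))"
  by pat_completeness auto
termination
  by (relation "inv_image {(x, y). x < y} snd") (auto simp: wf_ordinal)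

text \<open>The supremum of the empty set is \<open>0\<close>.\<close>

function times_countable_ordinal :: "countable_ordinal \<Rightarrow> countable_ordinal \<Rightarrow> countable_ordinal"
  where "times_countable_ordinal \<alpha> \<beta> = (SUP \<gamma>\<in>{..<\<beta>}. times_countable_ordinal \<alpha> \<gamma> + \<alpha>)"
  by pat_completeness auto
termination
  by (relation "inv_image {(x, y). x < y} snd") (auto simp: wf_ordinal)

instance ..

end

declare plus_countable_ordinal.simps [simp del] times_countable_ordinal.simps [simp del]

definition omega :: countable_ordinal where
  "omega = (SUP n. (osuc ^^ n) 0)"

function omega_power :: "countable_ordinal \<Rightarrow> countable_ordinal" where
  "omega_power \<beta> = (if \<beta> = 0 then 1 else SUP \<gamma>\<in>{..<\<beta>}. omega_power \<gamma> * omega)"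
  by pat_completeness auto
termination
  by (relation "{(x, y). x < y}") (auto simp: wf_ordinal)

declare omega_power.simps [simp del]

definition is_limit :: "countable_ordinal \<Rightarrow> bool" where
  "is_limit \<alpha> \<longleftrightarrow> \<alpha> \<noteq> 0 \<and> \<not> (\<exists>\<beta>. \<alpha> = \<beta> + 1)"


subsection \<open>The usual recursion equations\<close>

lemma ordinal_zero_le [simp]: "0 \<le> (\<alpha> :: countable_ordinal)"
  unfolding zero_countable_ordinal_def by (rule Least_le) simp

lemma ordinal_not_less_zero [simp]: "\<not> \<alpha> < (0 :: countable_ordinal)"
  by (simp add: not_less)

lemma ordinal_le_zero_iff [simp]: "\<alpha> \<le> 0 \<longleftrightarrow> \<alpha> = (0 :: countable_ordinal)"
  by (simp add: order.eq_iff)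

lemma pos_iff: "0 < \<alpha> \<longleftrightarrow> \<alpha> \<noteq> (0 :: countable_ordinal)"
  by (metis ordinal_zero_le order_le_less ordinal_not_less_zero)

lemma SUP_le_iff_ordinal:
  fixes z :: countable_ordinal
  assumes "countable A"
  shows "(SUP x\<in>A. f x) \<le> z \<longleftrightarrow> (\<forall>x\<in>A. f x \<le> z)"
proof (cases "A = {}")
  case True
  then show ?thesis
    by (simp add: Sup_countable_ordinal_def flip: zero_countable_ordinal_def)
next
  case False
  then show ?thesis
    using assms by (simp add: cSUP_le_iff countable_imp_bdd_above)
qed

lemma less_SUP_iff_ordinal:
  fixes z :: countable_ordinal
  assumes "countable A"
  shows "z < (SUP x\<in>A. f x) \<longleftrightarrow> (\<exists>x\<in>A. z < f x)"
  using SUP_le_iff_ordinal[OF assms, of f z] by (auto simp flip: not_le)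

lemma less_osuc_self: "\<alpha> < osuc \<alpha>"
proof -
  have "\<exists>\<beta>. \<alpha> < \<beta>"
  proof (rule ccontr)
    assume "\<not> (\<exists>\<beta>. \<alpha> < \<beta>)"
    then have "(UNIV :: countable_ordinal set) = {..\<alpha>}"
      by (auto simp: not_less)
    then show False
      using countable_atMost_ordinal[of \<alpha>] uncountable_UNIV_ordinal by simp
  qed
  then show ?thesis
    unfolding osuc_def by (rule LeastI_ex)
qed

lemma osuc_le_iff: "osuc \<alpha> \<le> \<beta> \<longleftrightarrow> \<alpha> < \<beta>"
proof
  show "osuc \<alpha> \<le> \<beta> \<Longrightarrow> \<alpha> < \<beta>"
    using less_osuc_self by (rule less_le_trans)
  show "\<alpha> < \<beta> \<Longrightarrow> osuc \<alpha> \<le> \<beta>"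
    unfolding osuc_def by (rule Least_le)
qed

lemma less_osuc_iff: "\<alpha> < osuc \<beta> \<longleftrightarrow> \<alpha> \<le> \<beta>"
  using osuc_le_iff[of \<beta> \<alpha>] by (auto simp flip: not_le)

lemma plus_zero [simp]: "\<alpha> + 0 = (\<alpha> :: countable_ordinal)"
  by (simp add: plus_countable_ordinal.simps)

lemma less_plus_iff:
  fixes \<alpha> \<beta> z :: countable_ordinal
  assumes "\<beta> \<noteq> 0"
  shows "z < \<alpha> + \<beta> \<longleftrightarrow> (\<exists>\<gamma><\<beta>. z \<le> \<alpha> + \<gamma>)"
  using assms plus_countable_ordinal.simps[of \<alpha> \<beta>]
  by (auto simp: less_SUP_iff_ordinal countable_lessThan_ordinal less_osuc_iff)

lemma plus_strict_mono: "\<gamma> < \<beta> \<Longrightarrow> \<alpha> + \<gamma> < \<alpha> + (\<beta> :: countable_ordinal)"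
  using less_plus_iff[of \<beta> "\<alpha> + \<gamma>" \<alpha>] by (metis ordinal_not_less_zero order_refl)

lemma plus_less_iff [simp]: "\<alpha> + \<gamma> < \<alpha> + \<beta> \<longleftrightarrow> \<gamma> < (\<beta> :: countable_ordinal)"
  by (metis linorder_cases order.asym plus_strict_mono)

lemma plus_le_iff [simp]: "\<alpha> + \<gamma> \<le> \<alpha> + \<beta> \<longleftrightarrow> \<gamma> \<le> (\<beta> :: countable_ordinal)"
  by (simp flip: not_less)

lemma plus_left_cancel [simp]: "\<alpha> + \<gamma> = \<alpha> + \<beta> \<longleftrightarrow> \<gamma> = (\<beta> :: countable_ordinal)"
  by (simp add: order.eq_iff)

lemma le_plus_left: "\<alpha> \<le> \<alpha> + (\<beta> :: countable_ordinal)"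
  by (metis plus_le_iff plus_zero ordinal_zero_le)

lemma plus_le_iff_all:
  fixes \<alpha> \<beta> z :: countable_ordinal
  assumes "\<beta> \<noteq> 0"
  shows "\<alpha> + \<beta> \<le> z \<longleftrightarrow> (\<forall>\<gamma><\<beta>. \<alpha> + \<gamma> < z)"
  using less_plus_iff[OF assms, of z \<alpha>] by (meson leD leI)

lemma plus_assoc_ordinal: "\<alpha> + \<beta> + \<gamma> = \<alpha> + (\<beta> + \<gamma> :: countable_ordinal)"
proof (induction \<gamma> rule: less_induct)
  case (less \<gamma>)
  show ?case
  proof (cases "\<gamma> = 0")
    case False
    then have nz: "\<beta> + \<gamma> \<noteq> 0"
      by (metis less_plus_iff ordinal_not_less_zero order_refl pos_iff ordinal_zero_le)
    show ?thesis
    proof (rule antisym)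
      show "\<alpha> + \<beta> + \<gamma> \<le> \<alpha> + (\<beta> + \<gamma>)"
        using False less by (simp add: plus_le_iff_all[of \<gamma>])
      have "\<alpha> + \<epsilon> < \<alpha> + \<beta> + \<gamma>" if \<epsilon>: "\<epsilon> < \<beta> + \<gamma>" for \<epsilon>
      proof -
        obtain \<delta> where \<delta>: "\<delta> < \<gamma>" "\<epsilon> \<le> \<beta> + \<delta>"
          using \<epsilon> False by (auto simp: less_plus_iff)
        then have "\<alpha> + \<epsilon> \<le> \<alpha> + \<beta> + \<delta>"
          using less by simp
        also have "\<dots> < \<alpha> + \<beta> + \<gamma>"
          using \<delta> by simp
        finally show ?thesis .
      qed
      then show "\<alpha> + (\<beta> + \<gamma>) \<le> \<alpha> + \<beta> + \<gamma>"
        using nz by (simp add: plus_le_iff_all)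
    qed
  qed simp
qed

lemma zero_plus_ordinal: "0 + \<alpha> = (\<alpha> :: countable_ordinal)"
proof (induction \<alpha> rule: less_induct)
  case (less \<alpha>)
  show ?case
  proof (cases "\<alpha> = 0")
    case False
    have "z < 0 + \<alpha> \<longleftrightarrow> z < \<alpha>" for z
      using False less by (auto simp: less_plus_iff)
    then show ?thesis
      by (metis linorder_cases order.irrefl)
  qed simp
qed

instance countable_ordinal :: monoid_add
  by standard (simp_all add: plus_assoc_ordinal zero_plus_ordinal)

lemma ordinal_less_one_iff: "\<alpha> < 1 \<longleftrightarrow> \<alpha> = (0 :: countable_ordinal)"
  by (simp add: one_countable_ordinal_def less_osuc_iff)

lemma plus_one: "\<alpha> + 1 = osuc \<alpha>"
proof -
  have "(1 :: countable_ordinal) \<noteq> 0"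
    using ordinal_less_one_iff by force
  then have "z < \<alpha> + 1 \<longleftrightarrow> z < osuc \<alpha>" for z
    by (simp add: less_plus_iff ordinal_less_one_iff less_osuc_iff)
  then show ?thesis
    by (metis linorder_cases order.irrefl)
qed

lemma plus_plus_one: "\<alpha> + (\<beta> + 1) = (\<alpha> + \<beta>) + (1 :: countable_ordinal)"
  by (simp add: add.assoc)

lemma is_limit_less: "is_limit \<nu> \<Longrightarrow> \<alpha> < \<nu> \<Longrightarrow> \<alpha> + 1 < \<nu>"
  by (metis is_limit_def order_le_less osuc_le_iff plus_one)

lemma plus_limit:
  assumes "is_limit \<nu>"
  shows "\<alpha> + \<nu> = (SUP \<gamma>\<in>{..<\<nu>}. \<alpha> + \<gamma>)"
proof -
  have nz: "\<nu> \<noteq> 0"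
    using assms by (simp add: is_limit_def)
  have "z < \<alpha> + \<nu> \<longleftrightarrow> (\<exists>\<gamma><\<nu>. z < \<alpha> + \<gamma>)" for z
    unfolding less_plus_iff[OF nz]
    by (metis assms is_limit_less less_osuc_iff order_less_imp_le plus_one plus_plus_one)
  then have "z < \<alpha> + \<nu> \<longleftrightarrow> z < (SUP \<gamma>\<in>{..<\<nu>}. \<alpha> + \<gamma>)" for z
    by (auto simp: less_SUP_iff_ordinal countable_lessThan_ordinal)
  then show ?thesis
    by (metis linorder_cases order.irrefl)
qed

lemma less_times_iff:
  fixes \<alpha> \<beta> z :: countable_ordinal
  shows "z < \<alpha> * \<beta> \<longleftrightarrow> (\<exists>\<gamma><\<beta>. z < \<alpha> * \<gamma> + \<alpha>)"
  using times_countable_ordinal.simps[of \<alpha> \<beta>]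
  by (auto simp: less_SUP_iff_ordinal countable_lessThan_ordinal)

lemma ordinal_times_le_iff:
  fixes \<alpha> \<beta> z :: countable_ordinal
  shows "\<alpha> * \<beta> \<le> z \<longleftrightarrow> (\<forall>\<gamma><\<beta>. \<alpha> * \<gamma> + \<alpha> \<le> z)"
  using less_times_iff[of z \<alpha> \<beta>] by (meson leD leI)

lemma ordinal_times_zero [simp]: "\<alpha> * 0 = (0 :: countable_ordinal)"
  using ordinal_times_le_iff[of \<alpha> 0 0] by simp

lemma times_mono_right: "\<gamma> \<le> \<beta> \<Longrightarrow> \<alpha> * \<gamma> \<le> \<alpha> * (\<beta> :: countable_ordinal)"
  by (meson order_less_le_trans order_refl ordinal_times_le_iff)

lemma plus_mono_left: "\<alpha> \<le> \<alpha>' \<Longrightarrow> \<alpha> + \<beta> \<le> \<alpha>' + (\<beta> :: countable_ordinal)"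
proof (induction \<beta> rule: less_induct)
  case (less \<beta>)
  show ?case
  proof (cases "\<beta> = 0")
    case False
    then show ?thesis
      using less by (subst plus_le_iff_all) (auto intro: le_less_trans plus_strict_mono)
  qed (use less in simp)
qed

lemma times_plus_one: "\<alpha> * (\<beta> + 1) = \<alpha> * \<beta> + (\<alpha> :: countable_ordinal)"
proof (rule antisym)
  show "\<alpha> * (\<beta> + 1) \<le> \<alpha> * \<beta> + \<alpha>"
    by (subst ordinal_times_le_iff) (simp add: plus_one less_osuc_iff plus_mono_left times_mono_right)
  show "\<alpha> * \<beta> + \<alpha> \<le> \<alpha> * (\<beta> + 1)"
    by (metis less_osuc_self order_refl plus_one ordinal_times_le_iff)
qed

lemma times_limit:
  assumes "is_limit \<nu>"
  shows "\<alpha> * \<nu> = (SUP \<gamma>\<in>{..<\<nu>}. \<alpha> * \<gamma>)"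
proof -
  have "z < \<alpha> * \<nu> \<longleftrightarrow> (\<exists>\<gamma><\<nu>. z < \<alpha> * \<gamma>)" for z
    by (metis assms is_limit_less less_times_iff order_less_le_trans times_mono_right
        times_plus_one order_less_imp_le)
  then have "z < \<alpha> * \<nu> \<longleftrightarrow> z < (SUP \<gamma>\<in>{..<\<nu>}. \<alpha> * \<gamma>)" for z
    by (auto simp: less_SUP_iff_ordinal countable_lessThan_ordinal)
  then show ?thesis
    by (metis linorder_cases order.irrefl)
qed

lemma times_mono_left: "\<alpha> \<le> \<alpha>' \<Longrightarrow> \<alpha> * \<beta> \<le> \<alpha>' * (\<beta> :: countable_ordinal)"
proof (induction \<beta> rule: less_induct)
  case (less \<beta>)
  have "\<alpha> * \<gamma> + \<alpha> \<le> \<alpha>' * \<beta>" if "\<gamma> < \<beta>" for \<gamma>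
  proof -
    have "\<alpha> * \<gamma> + \<alpha> \<le> \<alpha>' * \<gamma> + \<alpha>"
      using less that by (simp add: plus_mono_left)
    also have "\<dots> \<le> \<alpha>' * \<gamma> + \<alpha>'"
      using less by simp
    also have "\<dots> \<le> \<alpha>' * \<beta>"
      using that ordinal_times_le_iff by blast
    finally show ?thesis .
  qed
  then show ?case
    by (simp add: ordinal_times_le_iff[of \<alpha>])
qed

lemma less_omega_iff: "\<alpha> < omega \<longleftrightarrow> (\<exists>n. \<alpha> = (osuc ^^ n) 0)"
proof
  assume "\<alpha> < omega"
  then obtain n where "\<alpha> < (osuc ^^ n) 0"
    unfolding omega_def by (auto simp: less_SUP_iff_ordinal)
  then show "\<exists>n. \<alpha> = (osuc ^^ n) 0"
    by (induction n) (auto simp: less_osuc_iff le_less)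
next
  assume "\<exists>n. \<alpha> = (osuc ^^ n) 0"
  then obtain n where "\<alpha> < (osuc ^^ Suc n) 0"
    using less_osuc_self by auto
  then show "\<alpha> < omega"
    unfolding omega_def by (subst less_SUP_iff_ordinal) blast+
qed

lemma omega_power_zero [simp]: "omega_power 0 = 1"
  by (simp add: omega_power.simps)

lemma omega_power_le_iff:
  assumes "\<beta> \<noteq> 0"
  shows "omega_power \<beta> \<le> z \<longleftrightarrow> (\<forall>\<gamma><\<beta>. omega_power \<gamma> * omega \<le> z)"
  using assms omega_power.simps[of \<beta>]
  by (auto simp: SUP_le_iff_ordinal countable_lessThan_ordinal)

lemma less_omega_power_iff:
  assumes "\<beta> \<noteq> 0"
  shows "z < omega_power \<beta> \<longleftrightarrow> (\<exists>\<gamma><\<beta>. z < omega_power \<gamma> * omega)"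
  using omega_power_le_iff[OF assms, of z] by (meson leD leI)

lemma le_times_omega: "\<alpha> \<le> \<alpha> * omega"
proof -
  have "\<alpha> * 0 + \<alpha> \<le> \<alpha> * omega"
    using ordinal_times_le_iff less_omega_iff by (metis funpow_0 order_refl)
  then show ?thesis
    by simp
qed

lemma omega_power_mono: "\<gamma> \<le> \<beta> \<Longrightarrow> omega_power \<gamma> \<le> omega_power \<beta>"
  by (metis le_times_omega ordinal_not_less_zero omega_power_le_iff order_le_less order_refl order_trans)

lemma omega_power_plus_one: "omega_power (\<beta> + 1) = omega_power \<beta> * omega"
proof (rule antisym)
  have nz: "\<beta> + 1 \<noteq> 0"
    by (metis less_osuc_self ordinal_not_less_zero plus_one)
  show "omega_power (\<beta> + 1) \<le> omega_power \<beta> * omega"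
    unfolding omega_power_le_iff[OF nz]
    by (simp add: plus_one less_osuc_iff omega_power_mono times_mono_left)
  show "omega_power \<beta> * omega \<le> omega_power (\<beta> + 1)"
    by (metis nz less_osuc_self omega_power_le_iff order_refl plus_one)
qed

lemma omega_power_limit:
  assumes "is_limit \<nu>"
  shows "omega_power \<nu> = (SUP \<gamma>\<in>{..<\<nu>}. omega_power \<gamma>)"
proof -
  have nz: "\<nu> \<noteq> 0"
    using assms by (simp add: is_limit_def)
  have "z < omega_power \<nu> \<longleftrightarrow> (\<exists>\<gamma><\<nu>. z < omega_power \<gamma>)" for z
    unfolding less_omega_power_iff[OF nz]
    by (metis assms is_limit_less le_times_omega omega_power_plus_one order_less_le_trans)
  then have "z < omega_power \<nu> \<longleftrightarrow> z < (SUP \<gamma>\<in>{..<\<nu>}. omega_power \<gamma>)" for z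
    by (auto simp: less_SUP_iff_ordinal countable_lessThan_ordinal)
  then show ?thesis
    by (metis linorder_cases order.irrefl)
qed


section \<open>Cantor normal form\<close>

definition is_cnf :: "countable_ordinal list \<Rightarrow> countable_ordinal \<Rightarrow> bool" where
  "is_cnf es \<alpha> \<longleftrightarrow> sorted_wrt (\<ge>) es \<and> \<alpha> = sum_list (map omega_power es)"

lemma times_finite_plus:
  "\<alpha> * (osuc ^^ m) 0 + \<alpha> * (osuc ^^ n) 0 = \<alpha> * (osuc ^^ (m + n)) (0 :: countable_ordinal)"
proof (induction n)
  case (Suc n)
  then show ?case
    by (simp flip: plus_one) (simp add: times_plus_one flip: add.assoc)
qed simp

lemma less_times_omega_iff: "z < \<alpha> * omega \<longleftrightarrow> (\<exists>n. z < \<alpha> * (osuc ^^ n) 0)"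
proof
  assume "z < \<alpha> * omega"
  then obtain n where "z < \<alpha> * (osuc ^^ n) 0 + \<alpha>"
    unfolding less_times_iff less_omega_iff by auto
  then have "z < \<alpha> * (osuc ^^ Suc n) 0"
    using times_plus_one[of \<alpha> "(osuc ^^ n) 0"] by (simp add: plus_one)
  then show "\<exists>n. z < \<alpha> * (osuc ^^ n) 0" ..
next
  assume "\<exists>n. z < \<alpha> * (osuc ^^ n) 0"
  then show "z < \<alpha> * omega"
    using less_omega_iff times_mono_right[of _ omega \<alpha>]
    by (metis order_less_imp_le order_less_le_trans)
qed

lemma omega_power_closed:
  assumes "x < omega_power \<epsilon>" "y < omega_power \<epsilon>"
  shows "x + y < omega_power \<epsilon>"
proof (cases "\<epsilon> = 0")
  case True
  then show ?thesis
    using assms by (simp add: ordinal_less_one_iff)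
next
  case False
  obtain \<gamma> \<delta> where \<gamma>: "\<gamma> < \<epsilon>" "x < omega_power \<gamma> * omega"
    and \<delta>: "\<delta> < \<epsilon>" "y < omega_power \<delta> * omega"
    using assms less_omega_power_iff[OF False] by blast
  define \<mu> where "\<mu> = max \<gamma> \<delta>"
  have "x < omega_power \<mu> * omega" "y < omega_power \<mu> * omega"
    using \<gamma> \<delta> omega_power_mono[of _ \<mu>] times_mono_left[of _ "omega_power \<mu>" omega]
    unfolding \<mu>_def by (meson max.cobounded1 max.cobounded2 order_less_le_trans)+
  then obtain m n where "x < omega_power \<mu> * (osuc ^^ m) 0" "y < omega_power \<mu> * (osuc ^^ n) 0"
    by (auto simp: less_times_omega_iff)
  then have "x + y < omega_power \<mu> * (osuc ^^ (m + n)) 0"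
    unfolding times_finite_plus[symmetric]
    by (meson order_le_less_trans order_less_imp_le plus_mono_left plus_strict_mono)
  then have "x + y < omega_power \<mu> * omega"
    using less_times_omega_iff by blast
  moreover have "\<mu> < \<epsilon>"
    using \<gamma> \<delta> by (simp add: \<mu>_def)
  ultimately show ?thesis
    using less_omega_power_iff[OF False] by blast
qed

lemma omega_power_pos: "0 < omega_power \<epsilon>"
  using omega_power_mono[of 0 \<epsilon>] by (simp add: one_countable_ordinal_def osuc_le_iff)

lemma omega_power_less_plus_one: "omega_power \<epsilon> < omega_power (\<epsilon> + 1)"
proof -
  have "omega_power \<epsilon> < omega_power \<epsilon> * (osuc ^^ 2) 0"
    using omega_power_pos[of \<epsilon>] plus_strict_mono[of 0 "omega_power \<epsilon>" "omega_power \<epsilon>"]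
    by (simp add: numeral_2_eq_2 flip: plus_one)
      (metis add_0 plus_zero times_plus_one ordinal_times_zero)
  then show ?thesis
    using less_times_omega_iff omega_power_plus_one by auto
qed

lemma omega_power_strict_mono: "\<gamma> < \<beta> \<Longrightarrow> omega_power \<gamma> < omega_power \<beta>"
  by (metis omega_power_less_plus_one omega_power_mono order_less_le_trans osuc_le_iff plus_one)

lemma le_omega_power: "\<alpha> \<le> omega_power \<alpha>"
proof (induction \<alpha> rule: less_induct)
  case (less \<alpha>)
  show ?case
  proof (rule ccontr)
    assume "\<not> ?thesis"
    then show False
      using less[of "omega_power \<alpha>"] omega_power_strict_mono[of "omega_power \<alpha>" \<alpha>]
      by (auto simp: not_le)
  qed
qed

lemma sum_omega_power_less:
  "\<forall>e\<in>set es. e \<le> \<epsilon> \<Longrightarrow> sum_list (map omega_power es) < omega_power (\<epsilon> + 1)"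
  by (induction es)
    (auto simp: omega_power_pos intro!: omega_power_closed
      intro: omega_power_strict_mono simp: plus_one less_osuc_iff)

lemma is_cnf_unique: "is_cnf es \<alpha> \<Longrightarrow> is_cnf fs \<alpha> \<Longrightarrow> es = fs"
proof (induction es arbitrary: fs \<alpha>)
  case Nil
  then show ?case
    using le_plus_left omega_power_pos
    by (cases fs) (auto simp: is_cnf_def, metis le_plus_left ordinal_le_zero_iff order_less_irrefl)
next
  case (Cons e es)
  have aux: "e \<le> f" if "is_cnf (e # es) \<alpha>" "is_cnf (f # fs) \<alpha>" for e f es fs
  proof (rule ccontr)
    assume "\<not> e \<le> f"
    then have "f + 1 \<le> e"
      by (simp add: plus_one osuc_le_iff)
    then have "omega_power (f + 1) \<le> omega_power e"
      by (rule omega_power_mono)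
    also have "\<dots> \<le> \<alpha>"
      using that(1) by (simp add: is_cnf_def le_plus_left)
    also have "\<alpha> < omega_power (f + 1)"
      using that(2) sum_omega_power_less[of "f # fs" f] by (auto simp: is_cnf_def)
    finally show False
      by simp
  qed
  show ?case
  proof (cases fs)
    case Nil
    then show ?thesis
      using Cons.prems
      by (auto simp: is_cnf_def) (metis le_plus_left ordinal_le_zero_iff omega_power_pos order_less_irrefl)
  next
    case (Cons f fs')
    then have "e = f"
      using Cons.prems aux by (meson order.antisym)
    then have "is_cnf es (sum_list (map omega_power es))"
      and "is_cnf fs' (sum_list (map omega_power es))"
      using Cons Cons.prems by (auto simp: is_cnf_def)
    then show ?thesis
      using Cons.IH Cons \<open>e = f\<close> by blast
  qed
qed

lemma ordinal_diff:
  fixes \<alpha> \<beta> :: countable_ordinal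
  assumes "\<alpha> \<le> \<beta>"
  shows "\<exists>\<gamma>. \<beta> = \<alpha> + \<gamma>"
proof -
  define \<gamma> where "\<gamma> = (LEAST \<gamma>. \<beta> \<le> \<alpha> + \<gamma>)"
  have "\<beta> \<le> \<alpha> + \<beta>"
    using plus_mono_left[of 0 \<alpha> \<beta>] by simp
  then have 1: "\<beta> \<le> \<alpha> + \<gamma>"
    unfolding \<gamma>_def by (rule LeastI)
  have "\<not> \<beta> < \<alpha> + \<gamma>"
  proof
    assume *: "\<beta> < \<alpha> + \<gamma>"
    then have "\<gamma> \<noteq> 0"
      using assms by auto
    then obtain \<delta> where "\<delta> < \<gamma>" "\<beta> \<le> \<alpha> + \<delta>"
      using * less_plus_iff by blast
    then show False
      unfolding \<gamma>_def using not_less_Least by blast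
  qed
  with 1 show ?thesis
    by (meson order_le_less)
qed

lemma is_cnf_exists: "\<exists>es. is_cnf es \<alpha>"
proof (induction \<alpha> rule: less_induct)
  case (less \<alpha>)
  show ?case
  proof (cases "\<alpha> = 0")
    case True
    then have "is_cnf [] \<alpha>"
      by (simp add: is_cnf_def)
    then show ?thesis ..
  next
    case False
    define \<mu> where "\<mu> = (LEAST \<mu>. \<alpha> < omega_power \<mu>)"
    have "\<alpha> < omega_power (\<alpha> + 1)"
      by (metis less_osuc_self le_omega_power order_less_le_trans plus_one)
    then have \<mu>: "\<alpha> < omega_power \<mu>"
      unfolding \<mu>_def by (rule LeastI)
    have min: "omega_power \<epsilon> \<le> \<alpha>" if "\<epsilon> < \<mu>" for \<epsilon>
      using that unfolding \<mu>_def by (meson not_less_Least not_less)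
    have "\<mu> \<noteq> 0"
      using \<mu> False by (metis ordinal_less_one_iff omega_power_zero)
    then obtain \<epsilon> where \<epsilon>: "\<epsilon> < \<mu>" "\<alpha> < omega_power (\<epsilon> + 1)"
      using \<mu> less_omega_power_iff[OF \<open>\<mu> \<noteq> 0\<close>, of \<alpha>] omega_power_plus_one by auto
    obtain \<beta> where \<beta>: "\<alpha> = omega_power \<epsilon> + \<beta>"
      using ordinal_diff min[OF \<epsilon>(1)] by blast
    have "\<beta> \<le> \<alpha>"
      unfolding \<beta> using plus_mono_left[of 0 "omega_power \<epsilon>" \<beta>] by simp
    moreover have "\<beta> \<noteq> \<alpha>"
    proof
      assume "\<beta> = \<alpha>"
      then have *: "\<alpha> = omega_power \<epsilon> + \<alpha>"
        using \<beta> by simp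
      have "omega_power \<epsilon> * (osuc ^^ n) 0 + \<alpha> = \<alpha>" for n
      proof (induction n)
        case (Suc n)
        then show ?case
          by (simp flip: plus_one) (simp add: times_plus_one add.assoc flip: *)
      qed simp
      then have "omega_power \<epsilon> * (osuc ^^ n) 0 \<le> \<alpha>" for n
        by (metis le_plus_left)
      moreover obtain n where "\<alpha> < omega_power \<epsilon> * (osuc ^^ n) 0"
        using \<epsilon>(2) by (auto simp: omega_power_plus_one less_times_omega_iff)
      ultimately show False
        by (simp add: leD)
    qed
    ultimately have "\<beta> < \<alpha>"
      by simp
    then obtain es where es: "is_cnf es \<beta>"
      using less by blast
    have "e \<le> \<epsilon>" if "e \<in> set es" for e
    proof (cases es)
      case (Cons f fs)
      then have "e \<le> f"
        using es that by (auto simp: is_cnf_def)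
      have "omega_power f \<le> \<beta>"
        using es Cons by (simp add: is_cnf_def le_plus_left)
      then have "omega_power f < omega_power (\<epsilon> + 1)"
        using \<open>\<beta> < \<alpha>\<close> \<epsilon> by simp
      then have "f < \<epsilon> + 1"
        by (meson omega_power_mono leD leI)
      with \<open>e \<le> f\<close> show ?thesis
        by (simp add: plus_one less_osuc_iff)
    qed (use that in simp)
    then have "is_cnf (\<epsilon> # es) \<alpha>"
      using es \<beta> by (auto simp: is_cnf_def)
    then show ?thesis ..
  qed
qed

definition cnf :: "countable_ordinal \<Rightarrow> countable_ordinal list" where
  "cnf \<alpha> = (THE es. is_cnf es \<alpha>)"

lemma is_cnf_cnf: "is_cnf (cnf \<alpha>) \<alpha>"
  unfolding cnf_def using is_cnf_exists is_cnf_unique by (metis the_equality)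

text \<open>To be used only for \<open>\<eta> > 0\<close>, so that both lists in the second disjunct are nonempty.\<close>

definition normal_sum :: "countable_ordinal \<Rightarrow> countable_ordinal \<Rightarrow> bool" where
  "normal_sum \<xi> \<eta> \<longleftrightarrow> \<xi> = 0 \<or> hd (cnf \<eta>) \<le> last (cnf \<xi>)"


section \<open>Systems of ordinal notations with fundamental sequences\<close>

text \<open>\<open>fs \<alpha> n\<close> is \<open>\<alpha>[n]\<close>; its values for \<open>\<alpha> \<ge> \<tau>\<close> are irrelevant. \<open>ms\<close> is the
  master sequence.\<close>

locale ordinal_notation_system =
  fixes \<tau> :: countable_ordinal
    and fs :: "countable_ordinal \<Rightarrow> nat \<Rightarrow> countable_ordinal"
    and ms :: "nat \<Rightarrow> countable_ordinal"
  assumes limit_\<tau>: "is_limit \<tau>"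
    and fs_less_\<tau>: "\<alpha> < \<tau> \<Longrightarrow> fs \<alpha> n < \<tau>"
    and fs_zero: "fs 0 n = 0"
    and fs_one: "fs 1 n = 0"
    and fs_plus: "0 < \<eta> \<Longrightarrow> \<xi> + \<eta> < \<tau> \<Longrightarrow> normal_sum \<xi> \<eta> \<Longrightarrow> fs (\<xi> + \<eta>) n = \<xi> + fs \<eta> n"
    and fs_strict_mono: "is_limit \<nu> \<Longrightarrow> \<nu> < \<tau> \<Longrightarrow> strict_mono (fs \<nu>)"
    and fs_SUP: "is_limit \<nu> \<Longrightarrow> \<nu> < \<tau> \<Longrightarrow> (SUP n. fs \<nu> n) = \<nu>"
    and fs_pos: "is_limit \<nu> \<Longrightarrow> \<nu> < \<tau> \<Longrightarrow> 0 < fs \<nu> 0"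
    and bachmann: "\<alpha> < \<tau> \<Longrightarrow> \<beta> < \<tau> \<Longrightarrow> fs \<alpha> n < \<beta> \<Longrightarrow> \<beta> < \<alpha> \<Longrightarrow> fs \<alpha> n \<le> fs \<beta> 0"
    and ms_less_\<tau>: "ms n < \<tau>"
    and ms_strict_mono: "strict_mono ms"
    and ms_SUP: "(SUP n. ms n) = \<tau>"
    and fs_ms: "fs (ms (Suc n)) 0 = ms n"

text \<open>The test \<open>fs \<alpha> (k - 1) < \<alpha>\<close> in the following two definitions only serves termination: it holds
  for every limit \<open>\<alpha>\<close> below \<open>\<tau>\<close> in a system of ordinal notations, where the intended recursion
  equations are satisfied (lemmas \<open>G_limit\<close> and \<open>P_limit\<close>).\<close>

function G :: "(countable_ordinal \<Rightarrow> nat \<Rightarrow> countable_ordinal) \<Rightarrow> nat \<Rightarrow> countable_ordinal \<Rightarrow> nat"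
  where "G fs k \<alpha> =
    (if \<alpha> = 0 then 0
     else if \<exists>\<beta>. \<alpha> = \<beta> + 1 then G fs k (THE \<beta>. \<alpha> = \<beta> + 1) + 1
     else if fs \<alpha> (k - 1) < \<alpha> then G fs k (fs \<alpha> (k - 1))
     else 0)"
  by auto

lemma osuc_inject: "osuc \<alpha> = osuc \<beta> \<longleftrightarrow> \<alpha> = \<beta>"
  by (metis less_osuc_iff order.antisym order_refl)

lemma the_predecessor [simp]: "(THE \<gamma>. \<beta> + 1 = \<gamma> + (1 :: countable_ordinal)) = \<beta>"
  by (auto simp: plus_one osuc_inject)

termination G
  by (relation "inv_image {(x, y). x < y} (snd \<circ> snd)")
    (auto simp: wf_ordinal plus_one osuc_inject less_osuc_self)

declare G.simps [simp del]

function P :: "(countable_ordinal \<Rightarrow> nat \<Rightarrow> countable_ordinal) \<Rightarrow> nat \<Rightarrow> countable_ordinal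
    \<Rightarrow> countable_ordinal"
  where "P fs k \<alpha> =
    (if \<alpha> = 0 then 0
     else if \<exists>\<beta>. \<alpha> = \<beta> + 1 then (THE \<beta>. \<alpha> = \<beta> + 1)
     else if fs \<alpha> (k - 1) < \<alpha> then P fs k (fs \<alpha> (k - 1))
     else 0)"
  by pat_completeness auto
termination P
  by (relation "inv_image {(x, y). x < y} (snd \<circ> snd)") (auto simp: wf_ordinal)

declare P.simps [simp del]

lemma plus_one_neq_zero: "\<alpha> + 1 \<noteq> (0 :: countable_ordinal)"
  by (metis less_osuc_self ordinal_not_less_zero plus_one)

lemma G_zero: "G fs k 0 = 0"
  by (simp add: G.simps)

lemma G_plus_one: "G fs k (\<alpha> + 1) = G fs k \<alpha> + 1"
  by (subst G.simps) (auto simp: plus_one_neq_zero)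

lemma P_zero: "P fs k 0 = 0"
  by (simp add: P.simps)

lemma P_plus_one: "P fs k (\<alpha> + 1) = \<alpha>"
  by (subst P.simps) (auto simp: plus_one_neq_zero)

context ordinal_notation_system
begin

lemma fs_limit_less:
  assumes "is_limit \<nu>" "\<nu> < \<tau>"
  shows "fs \<nu> n < \<nu>"
proof -
  have "fs \<nu> n < fs \<nu> (Suc n)"
    using fs_strict_mono[OF assms] by (simp add: strict_mono_def)
  then have "fs \<nu> n < (SUP n. fs \<nu> n)"
    by (subst less_SUP_iff_ordinal) blast+
  then show ?thesis
    by (simp add: fs_SUP[OF assms])
qed

lemma G_limit: "is_limit \<nu> \<Longrightarrow> \<nu> < \<tau> \<Longrightarrow> G fs k \<nu> = G fs k (fs \<nu> (k - 1))"
  by (subst G.simps) (auto simp: is_limit_def fs_limit_less)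

lemma P_limit: "is_limit \<nu> \<Longrightarrow> \<nu> < \<tau> \<Longrightarrow> P fs k \<nu> = P fs k (fs \<nu> (k - 1))"
  by (subst P.simps) (auto simp: is_limit_def fs_limit_less)

end

text \<open>The maximality quotient \<open>\<tau>/G\<^sub>k\<close>. Being the maximum of a set is spelled out instead of
  choosing a maximum, so that the definition does not presuppose its existence.\<close>

definition max_quotient ::
  "countable_ordinal \<Rightarrow> (countable_ordinal \<Rightarrow> nat \<Rightarrow> countable_ordinal) \<Rightarrow> nat \<Rightarrow> countable_ordinal set"
  where "max_quotient \<tau> fs k =
    {\<mu>. \<exists>m. \<mu> \<in> {\<alpha>. \<alpha> < \<tau> \<and> G fs k \<alpha> = m} \<and> (\<forall>\<alpha>\<in>{\<alpha>. \<alpha> < \<tau> \<and> G fs k \<alpha> = m}. \<alpha> \<le> \<mu>)}"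

end

theory Submission
  imports Defs
begin

text \<open>
  \<open>G k \<alpha>\<close> counts the successor steps on the path \<open>\<alpha>, \<alpha>[k-1], \<alpha>[k-1][k-1], \<dots>, 0\<close> (a successor
  steps to its predecessor). The function \<open>G k\<close> is not monotone, but the Bachmann property says
  that the path of an ordinal strictly between \<open>\<alpha>[n]\<close> and \<open>\<alpha>\<close> cannot jump over \<open>\<alpha>[n]\<close>. As
  \<open>k - 1 \<ge> 1\<close>, a limit step even ends strictly above \<open>\<alpha>[n]\<close>, so that \<open>\<alpha>[n]\<close> is entered by a
  successor step. Hence \<open>G k\<close> exceeds \<open>G k (\<alpha>[n])\<close> on the whole open interval between \<open>\<alpha>[n]\<close> and
  \<open>\<alpha>\<close> (lemma \<open>G_less_between\<close>), and everything else follows from this.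

  Applied to the master sequence it bounds the sublevel sets \<open>{\<alpha>. G k \<alpha> \<le> m}\<close> below \<open>\<tau>\<close>
  (\<open>G_le_imp_le_ms\<close>). Applied to the supremum \<open>s\<close> of such a set it shows that \<open>s\<close> is attained:
  otherwise \<open>s\<close> is a limit with \<open>G k (s[k-1]) = G k s > m\<close>, and so \<open>G k > m\<close> on the whole
  interval between \<open>s[k-1]\<close> and \<open>s\<close>. The maximum takes the value \<open>m\<close>, because adding \<open>1\<close> raises
  \<open>G k\<close> by only \<open>1\<close>. So the maximum of a fibre is the maximum of the whole sublevel set
  (\<open>max_quotient_iff\<close>), and these maxima are ordered as their values.

  Finally \<open>P k \<alpha>\<close> is where the first successor step on the path of \<open>\<alpha>\<close> ends, with value
  \<open>G k \<alpha> - 1\<close>. By the same interval argument, applied to each limit step before it, \<open>G k\<close> is at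
  least \<open>G k \<alpha>\<close> between \<open>P k \<alpha>\<close> (exclusive) and \<open>\<alpha>\<close>. If \<open>\<alpha>\<close> is the maximum of its sublevel set,
  then \<open>P k \<alpha>\<close> is the maximum of the preceding one.
\<close>

section \<open>Paths and the Bachmann property\<close>

lemma ordinal_cases [case_names zero succ limit]:
  fixes \<alpha> :: countable_ordinal
  obtains "\<alpha> = 0" | \<beta> where "\<alpha> = \<beta> + 1" | "is_limit \<alpha>"
  by (auto simp: is_limit_def)

lemma less_plus_one_iff: "\<alpha> < \<beta> + 1 \<longleftrightarrow> \<alpha> \<le> (\<beta> :: countable_ordinal)"
  by (simp add: plus_one less_osuc_iff)

lemma less_plus_one_self: "\<alpha> < \<alpha> + (1 :: countable_ordinal)"
  by (simp add: less_plus_one_iff)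

context ordinal_notation_system
begin

text \<open>The reason for \<open>k \<ge> 2\<close>: the Bachmann property bounds \<open>\<nu>[0]\<close> from below, and the step of
  \<open>G k\<close> at a limit \<open>\<nu>\<close> has to stay strictly above that bound.\<close>

lemma fs_0_less:
  assumes "is_limit \<nu>" "\<nu> < \<tau>" "k \<ge> 2"
  shows "fs \<nu> 0 < fs \<nu> (k - 1)"
  using fs_strict_mono[OF assms(1,2)] \<open>k \<ge> 2\<close> by (auto simp: strict_mono_def)

text \<open>On the path of \<open>\<beta>\<close>, a limit \<open>\<gamma>\<close> in the interval is followed by
  \<open>\<gamma>[k-1] > \<gamma>[0] \<ge> \<alpha>[n]\<close>, again in the interval. So the path leaves the interval by a successor
  step, which ends in \<open>\<alpha>[n]\<close>.\<close>

lemma G_less_between: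
  assumes "k \<ge> 2" "\<alpha> < \<tau>" "fs \<alpha> n < \<beta>" "\<beta> < \<alpha>"
  shows "G fs k (fs \<alpha> n) < G fs k \<beta>"
  using assms(3,4)
proof (induction \<beta> rule: less_induct)
  case (less \<beta>)
  have \<beta>: "\<beta> < \<tau>"
    using less.prems \<open>\<alpha> < \<tau>\<close> by simp
  show ?case
  proof (cases \<beta> rule: ordinal_cases)
    case zero
    then show ?thesis
      using less.prems by simp
  next
    case (succ \<gamma>)
    then have "fs \<alpha> n = \<gamma> \<or> fs \<alpha> n < \<gamma>" "\<gamma> < \<beta>"
      using less.prems by (auto simp: less_plus_one_iff)
    then have "G fs k (fs \<alpha> n) \<le> G fs k \<gamma>"
      using less by fastforce
    then show ?thesis
      by (simp add: succ G_plus_one)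
  next
    case limit
    have "fs \<alpha> n \<le> fs \<beta> 0"
      using bachmann \<open>\<alpha> < \<tau>\<close> \<beta> less.prems by blast
    also have "\<dots> < fs \<beta> (k - 1)"
      using fs_0_less limit \<beta> \<open>k \<ge> 2\<close> by blast
    finally have "G fs k (fs \<alpha> n) < G fs k (fs \<beta> (k - 1))"
      using less fs_limit_less[OF limit \<beta>] by (meson less_trans)
    then show ?thesis
      by (simp add: G_limit[OF limit \<beta>])
  qed
qed

text \<open>For \<open>n = 0\<close> the right end point can be added to the interval of \<open>G_less_between\<close>: a limit
  step of \<open>\<alpha>\<close> ends strictly above \<open>\<alpha>[0]\<close>, and a successor step contributes \<open>1\<close> itself.\<close>

lemma G_fs_0_less:
  assumes "k \<ge> 2" "\<alpha> < \<tau>" "fs \<alpha> 0 < \<alpha>"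
  shows "G fs k (fs \<alpha> 0) < G fs k \<alpha>"
proof (cases \<alpha> rule: ordinal_cases)
  case zero
  then show ?thesis
    using assms by simp
next
  case (succ \<gamma>)
  then have "fs \<alpha> 0 = \<gamma> \<or> fs \<alpha> 0 < \<gamma>" "\<gamma> < \<alpha>"
    using assms by (auto simp: less_plus_one_iff)
  then have "G fs k (fs \<alpha> 0) \<le> G fs k \<gamma>"
    using G_less_between[of k \<alpha> 0 \<gamma>] assms by fastforce
  then show ?thesis
    by (simp add: succ G_plus_one)
next
  case limit
  then show ?thesis
    using G_less_between[of k \<alpha> 0 "fs \<alpha> (k - 1)"] fs_0_less fs_limit_less G_limit assms by auto
qed

section \<open>Maxima of sublevel sets and the maximality quotient\<close>

lemma strict_mono_G_ms:
  assumes "k \<ge> 2"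
  shows "strict_mono (\<lambda>n. G fs k (ms n))"
proof -
  have "G fs k (ms n) < G fs k (ms (Suc n))" for n
    using G_fs_0_less[OF assms ms_less_\<tau>, of "Suc n"] ms_strict_mono
    by (simp add: fs_ms strict_mono_Suc_iff)
  then show ?thesis
    by (simp add: strict_mono_Suc_iff)
qed

text \<open>An ordinal above \<open>ms m\<close> lies in some \<open>(ms n, ms (n + 1)]\<close> with \<open>n \<ge> m\<close>. The left end point of
  this interval is \<open>(ms (n + 1))[0]\<close>, and \<open>G k\<close> has at least the value \<open>n\<close> there.\<close>

lemma G_le_imp_le_ms:
  assumes "k \<ge> 2" "\<alpha> < \<tau>" "G fs k \<alpha> \<le> m"
  shows "\<alpha> \<le> ms m"
proof (rule ccontr)
  assume m: "\<not> \<alpha> \<le> ms m"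
  define N where "N = (LEAST N. \<alpha> \<le> ms N)"
  have "\<exists>N. \<alpha> < ms N"
    using \<open>\<alpha> < \<tau>\<close> less_SUP_iff_ordinal[of UNIV \<alpha> ms] by (simp add: ms_SUP)
  then have N: "\<alpha> \<le> ms N"
    unfolding N_def by (meson LeastI less_imp_le)
  have "m < N"
    using m N strict_mono_mono[OF ms_strict_mono] by (meson monoD not_le order_trans)
  then obtain n where n: "N = Suc n" "m \<le> n"
    by (cases N) auto
  have "ms n < \<alpha>"
    using not_less_Least[of n "\<lambda>N. \<alpha> \<le> ms N"] n(1) unfolding N_def by auto
  then have "G fs k (ms n) < G fs k \<alpha>"
    using G_less_between[OF \<open>k \<ge> 2\<close> ms_less_\<tau>[of "Suc n"], of 0 \<alpha>]
      strict_monoD[OF strict_mono_G_ms[OF \<open>k \<ge> 2\<close>], of n "Suc n"] N n(1)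
    by (cases "\<alpha> = ms (Suc n)") (auto simp: fs_ms)
  moreover have "n \<le> G fs k (ms n)"
    using strict_mono_G_ms[OF \<open>k \<ge> 2\<close>] by (rule strict_mono_imp_increasing)
  ultimately show False
    using assms(3) n(2) by simp
qed

text \<open>The supremum of the sublevel set is attained by the interval argument of \<open>G_less_between\<close>.\<close>

lemma sublevel_max_exists:
  assumes "k \<ge> 2"
  shows "\<exists>\<mu><\<tau>. G fs k \<mu> = m \<and> (\<forall>\<alpha><\<tau>. G fs k \<alpha> \<le> m \<longrightarrow> \<alpha> \<le> \<mu>)"
proof -
  define S where "S = {\<alpha>. \<alpha> < \<tau> \<and> G fs k \<alpha> \<le> m}"
  define s where "s = Sup S"
  have le_ms: "\<alpha> \<le> ms m" if "\<alpha> \<in> S" for \<alpha>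
    using that G_le_imp_le_ms[OF assms] by (simp add: S_def)
  have "0 \<in> S"
    using limit_\<tau> by (simp add: S_def G_zero is_limit_def pos_iff)
  then have ne: "S \<noteq> {}"
    by blast
  have bdd: "bdd_above S"
    using le_ms by (meson bdd_aboveI)
  have upper: "\<alpha> \<le> s" if "\<alpha> \<in> S" for \<alpha>
    unfolding s_def using that bdd by (rule cSup_upper)
  have "s \<le> ms m"
    unfolding s_def using ne le_ms by (rule cSup_least)
  then have "s < \<tau>"
    using ms_less_\<tau> by (rule le_less_trans)
  have "s \<in> S"
  proof (rule ccontr)
    assume "s \<notin> S"
    have approx: "\<exists>\<beta>\<in>S. \<gamma> < \<beta> \<and> \<beta> < s" if "\<gamma> < s" for \<gamma>
      using that less_cSup_iff[OF ne bdd, of \<gamma>] upper \<open>s \<notin> S\<close> unfolding s_def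
      by (metis order_le_less)
    show False
    proof (cases s rule: ordinal_cases)
      case zero
      then show False
        using \<open>0 \<in> S\<close> \<open>s \<notin> S\<close> by simp
    next
      case (succ \<gamma>)
      then show False
        using approx[of \<gamma>] by (auto simp: less_plus_one_iff)
    next
      case limit
      obtain \<beta> where \<beta>: "\<beta> \<in> S" "fs s (k - 1) < \<beta>" "\<beta> < s"
        using approx fs_limit_less[OF limit \<open>s < \<tau>\<close>] by blast
      have "m < G fs k s"
        using \<open>s \<notin> S\<close> \<open>s < \<tau>\<close> by (simp add: S_def)
      also have "\<dots> < G fs k \<beta>"
        using G_less_between[OF assms \<open>s < \<tau>\<close> \<beta>(2,3)] by (simp add: G_limit[OF limit \<open>s < \<tau>\<close>])
      finally show False
        using \<beta>(1) by (simp add: S_def)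
    qed
  qed
  moreover have "s + 1 \<notin> S"
    using upper less_plus_one_self by (meson leD)
  then have "\<not> G fs k s < m"
    using is_limit_less[OF limit_\<tau> \<open>s < \<tau>\<close>] by (simp add: S_def G_plus_one)
  ultimately show ?thesis
    using upper by (auto simp: S_def)
qed

text \<open>By \<open>sublevel_max_exists\<close> some ordinal with value \<open>G k \<mu>\<close> is maximal even in the sublevel set,
  and it cannot exceed the maximum of the fibre.\<close>

lemma max_quotient_iff:
  assumes "k \<ge> 2"
  shows "\<mu> \<in> max_quotient \<tau> fs k
    \<longleftrightarrow> \<mu> < \<tau> \<and> (\<forall>\<alpha><\<tau>. G fs k \<alpha> \<le> G fs k \<mu> \<longrightarrow> \<alpha> \<le> \<mu>)"
proof
  assume "\<mu> \<in> max_quotient \<tau> fs k"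
  then have \<mu>: "\<mu> < \<tau>" "\<And>\<alpha>. \<alpha> < \<tau> \<Longrightarrow> G fs k \<alpha> = G fs k \<mu> \<Longrightarrow> \<alpha> \<le> \<mu>"
    by (auto simp: max_quotient_def)
  obtain \<nu> where \<nu>: "\<nu> < \<tau>" "G fs k \<nu> = G fs k \<mu>"
    "\<forall>\<alpha><\<tau>. G fs k \<alpha> \<le> G fs k \<mu> \<longrightarrow> \<alpha> \<le> \<nu>"
    using sublevel_max_exists[OF assms] by blast
  then show "\<mu> < \<tau> \<and> (\<forall>\<alpha><\<tau>. G fs k \<alpha> \<le> G fs k \<mu> \<longrightarrow> \<alpha> \<le> \<mu>)"
    using \<mu> by (meson order_trans)
qed (auto simp: max_quotient_def)

section \<open>The predecessor function\<close>

lemma P_less_and_G_P: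
  assumes "\<alpha> < \<tau>" "\<alpha> \<noteq> 0"
  shows "P fs k \<alpha> < \<alpha> \<and> G fs k \<alpha> = Suc (G fs k (P fs k \<alpha>))"
  using assms
proof (induction \<alpha> rule: less_induct)
  case (less \<alpha>)
  show ?case
  proof (cases \<alpha> rule: ordinal_cases)
    case zero
    then show ?thesis
      using less.prems by simp
  next
    case (succ \<gamma>)
    then show ?thesis
      by (simp add: P_plus_one G_plus_one less_plus_one_self)
  next
    case limit
    let ?\<delta> = "fs \<alpha> (k - 1)"
    have "?\<delta> < \<alpha>"
      by (rule fs_limit_less[OF limit less.prems(1)])
    moreover have "fs \<alpha> 0 \<le> ?\<delta>"
      using fs_strict_mono[OF limit less.prems(1)] by (simp add: strict_mono_less_eq)
    then have "?\<delta> \<noteq> 0"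
      using fs_pos[OF limit less.prems(1)] by auto
    ultimately show ?thesis
      using less.IH[of ?\<delta>] fs_less_\<tau>[OF less.prems(1)]
      by (auto simp: P_limit[OF limit less.prems(1)] G_limit[OF limit less.prems(1)]
          intro: less_trans)
  qed
qed

text \<open>Up to the first successor step, the path of \<open>\<alpha>\<close> cuts the interval into pieces between an
  ordinal and its \<open>[k-1]\<close>, on each of which \<open>G_less_between\<close> applies; the value of \<open>G k\<close> at all
  the cutting points is \<open>G k \<alpha>\<close>.\<close>

lemma G_le_between_P:
  assumes "k \<ge> 2" "\<alpha> < \<tau>" "P fs k \<alpha> < \<beta>" "\<beta> \<le> \<alpha>"
  shows "G fs k \<alpha> \<le> G fs k \<beta>"
  using assms(2-4)
proof (induction \<alpha> rule: less_induct)
  case (less \<alpha>)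
  show ?case
  proof (cases \<alpha> rule: ordinal_cases)
    case zero
    then show ?thesis
      by (simp add: G_zero)
  next
    case (succ \<gamma>)
    then have "\<beta> = \<alpha>"
      using less.prems by (auto simp: P_plus_one less_plus_one_iff order_le_less)
    then show ?thesis
      by simp
  next
    case limit
    note lim = limit less.prems(1)
    consider "\<beta> \<le> fs \<alpha> (k - 1)" | "fs \<alpha> (k - 1) < \<beta>" "\<beta> < \<alpha>" | "\<beta> = \<alpha>"
      using less.prems(3) by fastforce
    then show ?thesis
    proof cases
      case 1
      then show ?thesis
        using less.IH[of "fs \<alpha> (k - 1)"] fs_limit_less[OF lim] fs_less_\<tau> less.prems
        by (simp add: G_limit[OF lim] P_limit[OF lim])
    next
      case 2
      then show ?thesis
        using G_less_between[OF \<open>k \<ge> 2\<close> less.prems(1)] by (simp add: G_limit[OF lim] less_imp_le)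
    qed simp
  qed
qed

section \<open>Order and predecessors on the maximality quotient\<close>

lemma max_quotient_le_iff:
  assumes "k \<ge> 2" "\<alpha> \<in> max_quotient \<tau> fs k" "\<beta> \<in> max_quotient \<tau> fs k"
  shows "\<alpha> \<le> \<beta> \<longleftrightarrow> G fs k \<alpha> \<le> G fs k \<beta>"
  using assms by (metis max_quotient_iff nle_le order_antisym_conv)

lemma bij_betw_G_max_quotient:
  assumes "k \<ge> 2"
  shows "bij_betw (G fs k) (max_quotient \<tau> fs k) UNIV"
proof (rule bij_betw_imageI)
  show "inj_on (G fs k) (max_quotient \<tau> fs k)"
    using max_quotient_le_iff[OF assms] by (simp add: inj_on_def order.eq_iff)
  have "m \<in> G fs k ` max_quotient \<tau> fs k" for m
    using sublevel_max_exists[OF assms, of m] max_quotient_iff[OF assms] by blast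
  then show "G fs k ` max_quotient \<tau> fs k = UNIV"
    by blast
qed

text \<open>An ordinal above \<open>P k \<alpha>\<close> has at least the value \<open>G k \<alpha> = G k (P k \<alpha>) + 1\<close>: up to \<open>\<alpha>\<close> by
  \<open>G_le_between_P\<close>, and beyond \<open>\<alpha>\<close> by the maximality of \<open>\<alpha>\<close>.\<close>

lemma P_in_max_quotient:
  assumes "k \<ge> 2" "\<alpha> \<in> max_quotient \<tau> fs k" "\<alpha> \<noteq> 0"
  shows "P fs k \<alpha> \<in> max_quotient \<tau> fs k"
proof -
  have \<alpha>: "\<alpha> < \<tau>" "\<And>\<beta>. \<beta> < \<tau> \<Longrightarrow> \<alpha> < \<beta> \<Longrightarrow> G fs k \<alpha> < G fs k \<beta>"
    using assms(2) max_quotient_iff[OF assms(1)] by (auto simp flip: not_le)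
  have P: "P fs k \<alpha> < \<alpha>" "G fs k \<alpha> = Suc (G fs k (P fs k \<alpha>))"
    using P_less_and_G_P[OF \<alpha>(1) assms(3)] by auto
  have "G fs k (P fs k \<alpha>) < G fs k \<beta>" if "\<beta> < \<tau>" "P fs k \<alpha> < \<beta>" for \<beta>
    using G_le_between_P[OF assms(1) \<alpha>(1) that(2)] \<alpha>(2)[OF that(1)] P(2) by (cases "\<beta> \<le> \<alpha>") (auto simp: not_le)
  then show ?thesis
    using P(1) \<alpha>(1) by (auto simp: max_quotient_iff[OF assms(1)] simp flip: not_less)
qed

lemma max_quotient_le_P:
  assumes "k \<ge> 2" "\<alpha> \<in> max_quotient \<tau> fs k" "\<beta> \<in> max_quotient \<tau> fs k" "\<beta> < \<alpha>"
  shows "\<beta> \<le> P fs k \<alpha>"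
proof -
  have "\<alpha> < \<tau>" "\<alpha> \<noteq> 0"
    using assms max_quotient_iff by auto
  then have "G fs k \<alpha> = Suc (G fs k (P fs k \<alpha>))"
    using P_less_and_G_P by blast
  moreover have "G fs k \<beta> < G fs k \<alpha>"
    using assms max_quotient_le_iff by (meson leD leI)
  ultimately show ?thesis
    using max_quotient_le_iff[OF assms(1,3) P_in_max_quotient[OF assms(1,2) \<open>\<alpha> \<noteq> 0\<close>]] by simp
qed

end

theorem theorem2p11:
  fixes \<tau> :: countable_ordinal
    and fs :: "countable_ordinal \<Rightarrow> nat \<Rightarrow> countable_ordinal"
    and ms :: "nat \<Rightarrow> countable_ordinal"
    and k :: nat
  assumes "ordinal_notation_system \<tau> fs ms"
    and "k \<ge> 2"
  shows "bij_betw (G fs k) (max_quotient \<tau> fs k) (UNIV :: nat set)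
    \<and> (\<forall>\<alpha>\<in>max_quotient \<tau> fs k. \<forall>\<beta>\<in>max_quotient \<tau> fs k. \<alpha> \<le> \<beta> \<longleftrightarrow> G fs k \<alpha> \<le> G fs k \<beta>)
    \<and> P fs k 0 = 0
    \<and> (\<forall>\<alpha>\<in>max_quotient \<tau> fs k. \<alpha> \<noteq> 0 \<longrightarrow>
         P fs k \<alpha> \<in> max_quotient \<tau> fs k \<and> P fs k \<alpha> < \<alpha>
         \<and> (\<forall>\<beta>\<in>max_quotient \<tau> fs k. \<beta> < \<alpha> \<longrightarrow> \<beta> \<le> P fs k \<alpha>))"
proof -
  interpret ordinal_notation_system \<tau> fs ms
    by fact
  have "P fs k \<alpha> < \<alpha>" if "\<alpha> \<in> max_quotient \<tau> fs k" "\<alpha> \<noteq> 0" for \<alpha>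
    using that P_less_and_G_P max_quotient_iff[OF \<open>k \<ge> 2\<close>] by blast
  then show ?thesis
    by (intro conjI ballI impI bij_betw_G_max_quotient max_quotient_le_iff P_zero
        P_in_max_quotient max_quotient_le_P \<open>k \<ge> 2\<close>)
qed

end
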